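(* For every $n > 3$, there is no exploration protocol, even probabilistic, of a ring of $n$ nodes with three robots.
   Context: Model. A ring has $n$ nodes $u_0,\dots,u_{n-1}$ (indices modulo $n$), $u_i$ adjacent to $u_{i-1}$ and $u_{i+1}$; nodes are anonymous and the ring is unoriented. There are $k\le n$ robots located on nodes. Robots are anonymous, uniform (same program, no local parameter), oblivious (no memory between cycles) and do not communicate. A protocol is this common program. Each robot repeatedly executes Look–Compute–Move cycles: in Look it observes the number $d_j(t)$ of robots on every node $u_j$ (multiplicity detection), seen from its own node $u_i$ as the unordered pair $\{\gamma^{+i}(t),\gamma^{-i}(t)\}$ with $\gamma^{+i}(t)=\langle d_i d_{i+1}\dots d_{i+n-1}\rangle$ and $\gamma^{-i}(t)=\langle d_i d_{i-1}\dots d_{i-(n-1)}\rangle$; in Compute it decides, deterministically or with randomness, to stay idle or move to a neighboring node; in Move it moves. If its view is symmetric ($\gamma^{+i}=\gamma^{-i}$) and it decides to move, an adversary chooses which incident edge it traverses. At each instant $t=0,1,2,\dots$ a nonempty set of robots is activated, each executing a full cycle atomically between $t$ and $t+1$. The configuration at instant $t$ is $\langle d_0(t)\dots d_{n-1}(t)\rangle$. A tower is a node holding at least two robots; towerless means no tower. A configuration is terminal if from it the probability that some robot moves is 0. A computation is an infinite sequence of configurations starting from a possible (towerless) initial configuration, each obtained from the previous after a nonempty set of robots executes a cycle; it terminates if it contains a terminal configuration. The scheduler is distributed and fair: any nonempty subset of robots may be activated at each instant (not necessarily one at a time) and every robot is activated infinitely often. A node is visited if some robot is on it at some instant. A protocol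 deterministically (resp. probabilistically) solves exploration — is an exploration protocol — if every computation starting from a towerless configuration terminates in finite time (resp. finite expected time; non-terminating computations have probability 0) and every node is visited by at least one robot during it. *)

theory Defs
  imports "HOL-Probability.Probability" "HOL-Library.Uprod"
begin

text \<open>
  The nodes of a ring of size \<open>n\<close> are \<open>0, \<dots>, n - 1\<close>. A \<^emph>\<open>placement\<close> lists the node of each
  robot; the robot names \<open>0, \<dots>, k - 1\<close> serve only to say whom the scheduler activates and are
  not available to the robots. A \<^emph>\<open>configuration\<close> \<open>\<langle>d\<^sub>0 \<dots> d\<^sub>n\<^sub>-\<^sub>1\<rangle>\<close> lists the number of robots on
  each node.
\<close>

type_synonym placement = "nat list"
type_synonym configuration = "nat list"

definition config :: "nat \<Rightarrow> placement \<Rightarrow> configuration" where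
  "config n p = map (count_list p) [0..<n]"

definition tower :: "configuration \<Rightarrow> nat \<Rightarrow> bool" where
  "tower c i \<longleftrightarrow> i < length c \<and> c ! i \<ge> 2"

definition towerless :: "configuration \<Rightarrow> bool" where
  "towerless c \<longleftrightarrow> (\<nexists>i. tower c i)"

definition next_node :: "nat \<Rightarrow> nat \<Rightarrow> nat" where
  "next_node n i = (i + 1) mod n"

definition prev_node :: "nat \<Rightarrow> nat \<Rightarrow> nat" where
  "prev_node n i = (i + n - 1) mod n"

definition gamma_plus :: "configuration \<Rightarrow> nat \<Rightarrow> nat list" where
  "gamma_plus c i = (let n = length c in map (\<lambda>m. c ! ((i + m) mod n)) [0..<n])"

definition gamma_minus :: "configuration \<Rightarrow> nat \<Rightarrow> nat list" where
  "gamma_minus c i = (let n = length c in map (\<lambda>m. c ! ((i + n - m) mod n)) [0..<n])"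

type_synonym view = "nat list uprod"

definition view :: "configuration \<Rightarrow> nat \<Rightarrow> view" where
  "view c i = Upair (gamma_plus c i) (gamma_minus c i)"

text \<open>
  As the ring is unoriented, a robot can name a direction only by what it sees there:
  \<open>Move w\<close> means moving in the direction in which the ring reads \<open>w\<close>. If the view is symmetric,
  both directions read \<open>w\<close> and the adversary resolves the choice.
\<close>

datatype decision = Idle | Move "nat list"

type_synonym protocol = "view \<Rightarrow> decision pmf"

definition valid_protocol :: "protocol \<Rightarrow> bool" where
  "valid_protocol P \<longleftrightarrow> (\<forall>V. set_pmf (P V) \<subseteq> insert Idle (Move ` set_uprod V))"

text \<open>In \<open>target c i a b\<close>, the adversary's choice \<open>b\<close> matters only for a symmetric view.\<close>

definition target :: "configuration \<Rightarrow> nat \<Rightarrow> decision \<Rightarrow> bool \<Rightarrow> nat" where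
  "target c i a b = (case a of
      Idle \<Rightarrow> i
    | Move w \<Rightarrow>
        if gamma_plus c i = gamma_minus c i
        then (if b then next_node (length c) i else prev_node (length c) i)
        else (if w = gamma_plus c i then next_node (length c) i else prev_node (length c) i))"

definition step :: "nat \<Rightarrow> placement \<Rightarrow> (nat \<Rightarrow> decision) \<Rightarrow> (nat \<Rightarrow> bool) \<Rightarrow> placement" where
  "step n p dec e = map (\<lambda>r. target (config n p) (p ! r) (dec r) (e r)) [0..<length p]"

definition terminal :: "protocol \<Rightarrow> configuration \<Rightarrow> bool" where
  "terminal P c \<longleftrightarrow>
    (\<forall>i<length c. c ! i > 0 \<longrightarrow> measure_pmf.prob (P (view c i)) (range Move) = 0)"

definition initial :: "nat \<Rightarrow> nat \<Rightarrow> placement \<Rightarrow> bool" where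
  "initial n k p \<longleftrightarrow> length p = k \<and> set p \<subseteq> {..<n} \<and> towerless (config n p)"

definition activation :: "nat \<Rightarrow> nat set \<Rightarrow> bool" where
  "activation k A \<longleftrightarrow> A \<noteq> {} \<and> A \<subseteq> {..<k}"

definition terminates :: "nat \<Rightarrow> protocol \<Rightarrow> (nat \<Rightarrow> placement) \<Rightarrow> bool" where
  "terminates n P X \<longleftrightarrow> (\<exists>t. terminal P (config n (X t)))"

definition visits_all :: "nat \<Rightarrow> (nat \<Rightarrow> placement) \<Rightarrow> bool" where
  "visits_all n X \<longleftrightarrow> (\<forall>j<n. \<exists>t. config n (X t) ! j > 0)"

subsection \<open>Deterministic exploration\<close>

definition possible_step ::
    "nat \<Rightarrow> protocol \<Rightarrow> placement \<Rightarrow> nat set \<Rightarrow> placement \<Rightarrow> bool" where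
  "possible_step n P p A q \<longleftrightarrow> activation (length p) A \<and>
    (\<exists>dec e. (\<forall>r<length p. if r \<in> A then dec r \<in> set_pmf (P (view (config n p) (p ! r)))
                           else dec r = Idle) \<and>
             q = step n p dec e)"

definition fair_computation ::
    "nat \<Rightarrow> nat \<Rightarrow> protocol \<Rightarrow> (nat \<Rightarrow> nat set) \<Rightarrow> (nat \<Rightarrow> placement) \<Rightarrow> bool" where
  "fair_computation n k P A X \<longleftrightarrow> initial n k (X 0) \<and>
    (\<forall>t. possible_step n P (X t) (A t) (X (Suc t))) \<and>
    (\<forall>r<k. \<exists>\<^sub>\<infinity>t. r \<in> A t)"

definition deterministically_solves :: "nat \<Rightarrow> nat \<Rightarrow> protocol \<Rightarrow> bool" where
  "deterministically_solves n k P \<longleftrightarrow>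
    (\<forall>A X. fair_computation n k P A X \<longrightarrow> terminates n P X \<and> visits_all n X)"

subsection \<open>Probabilistic exploration\<close>

text \<open>
  A scheduler is a history-dependent strategy: \<open>act h\<close> is the set of robots activated after the
  history \<open>h\<close> (the nonempty list of placements so far), and \<open>edge h dec r\<close> is the edge chosen for
  robot \<open>r\<close>, which may depend on the decisions just taken. Fairness is required along all
  sequences of placements; a scheduler that is fair only along the computations of a
  given protocol can be changed off those computations so as to satisfy this.
\<close>

type_synonym history = "placement list"
type_synonym activator = "history \<Rightarrow> nat set"
type_synonym edge_chooser = "history \<Rightarrow> (nat \<Rightarrow> decision) \<Rightarrow> nat \<Rightarrow> bool"

definition fair_scheduler :: "nat \<Rightarrow> activator \<Rightarrow> bool" where
  "fair_scheduler k act \<longleftrightarrow> (\<forall>h. activation k (act h)) \<and>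
    (\<forall>X :: nat \<Rightarrow> placement. \<forall>r<k. \<exists>\<^sub>\<infinity>t. r \<in> act (map X [0..<Suc t]))"

text \<open>
  \<open>\<omega> (t, r, V)\<close> is the decision robot \<open>r\<close> takes if it is activated at instant \<open>t\<close> with view \<open>V\<close>.
  These decisions are independent, and \<open>\<omega> (t, r, V)\<close> has law \<open>P V\<close>.
\<close>

type_synonym outcome = "nat \<times> nat \<times> view \<Rightarrow> decision"

definition coin_space :: "protocol \<Rightarrow> outcome measure" where
  "coin_space P = PiM UNIV (\<lambda>(t, r, V). measure_pmf (P V))"

primrec run_history ::
    "nat \<Rightarrow> activator \<Rightarrow> edge_chooser \<Rightarrow> placement \<Rightarrow> outcome \<Rightarrow> nat \<Rightarrow> history" where
  "run_history n act edge p \<omega> 0 = [p]"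
| "run_history n act edge p \<omega> (Suc t) =
    (let h = run_history n act edge p \<omega> t;
         q = last h;
         dec = (\<lambda>r. if r \<in> act h then \<omega> (t, r, view (config n q) (q ! r)) else Idle)
     in h @ [step n q dec (edge h dec)])"

definition run ::
    "nat \<Rightarrow> activator \<Rightarrow> edge_chooser \<Rightarrow> placement \<Rightarrow> outcome \<Rightarrow> nat \<Rightarrow> placement" where
  "run n act edge p \<omega> t = last (run_history n act edge p \<omega> t)"

definition termination_time :: "nat \<Rightarrow> protocol \<Rightarrow> (nat \<Rightarrow> placement) \<Rightarrow> ennreal" where
  "termination_time n P X = (INF t\<in>{t. terminal P (config n (X t))}. of_nat t)"

definition probabilistically_solves :: "nat \<Rightarrow> nat \<Rightarrow> protocol \<Rightarrow> bool" where
  "probabilistically_solves n k P \<longleftrightarrow>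
    (\<forall>act edge p. fair_scheduler k act \<and> initial n k p \<longrightarrow>
      (AE \<omega> in coin_space P. terminates n P (run n act edge p \<omega>)) \<and>
      (\<integral>\<^sup>+ \<omega>. termination_time n P (run n act edge p \<omega>) \<partial>coin_space P) < \<infinity> \<and>
      (AE \<omega> in coin_space P. visits_all n (run n act edge p \<omega>)))"

definition exploration_protocol :: "nat \<Rightarrow> nat \<Rightarrow> protocol \<Rightarrow> bool" where
  "exploration_protocol n k P \<longleftrightarrow>
    valid_protocol P \<and> (deterministically_solves n k P \<or> probabilistically_solves n k P)"

end

theory Submission imports Defs begin

text \<open>
  A terminal configuration must contain a tower, because a towerless one could be taken as initial. Up to
  symmetry, a placement of three robots with a tower is given by the distance \<open>d \<le> n / 2\<close> between
  the tower and the remaining robot. Under a sequential scheduler \<open>d\<close> changes by at most one per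
  step, so a terminating execution allows the scheduler to lead the single robot monotonically from
  the first distance to a terminal one. This visits at most \<open>3 + (n / 2 - 1)\<close> nodes, fewer than \<open>n\<close>
  unless \<open>n = 4\<close>. For \<open>n = 4\<close> a better choice of directions, or the simultaneous activation of two
  robots, keeps a node unvisited. Every finite execution used has positive probability, so the
  argument covers probabilistic protocols.
\<close>

section \<open>Playing a finite execution against a protocol\<close>

text \<open>There are only countably many triples of instant, robot and view, so the almost sure
  statements about single decisions hold simultaneously.\<close>

lemma AE_coin_space_support:
  "AE \<omega> in coin_space P. \<forall>t r V. \<omega> (t, r, V) \<in> set_pmf (P V)"
proof -
  have "countable (UNIV :: view set)"
  proof -
    have "V \<in> range (\<lambda>(x, y). Upair x y)" for V :: view
      by (cases V) (auto intro!: image_eqI[where x = "(_, _)"])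
    then have "UNIV = range (\<lambda>(x :: nat list, y). Upair x y)"
      by blast
    then show ?thesis
      by (metis countable_image countableI_type)
  qed
  then have "countable (UNIV :: (nat \<times> nat \<times> view) set)"
    by (metis UNIV_Times_UNIV countable_SIGMA countableI_type)
  moreover have "AE \<omega> in coin_space P. \<omega> i \<in> set_pmf (P (snd (snd i)))" for i
    unfolding coin_space_def
    by (rule AE_PiM_component)
      (auto simp: AE_measure_pmf_iff measure_pmf.prob_space_axioms split: prod.splits)
  ultimately have "AE \<omega> in coin_space P. \<forall>i\<in>UNIV. \<omega> i \<in> set_pmf (P (snd (snd i)))"
    by (subst AE_ball_countable) auto
  then show ?thesis
    by eventually_elim auto
qed

text \<open>Finitely many prescribed decisions, each of positive probability, have a positive
  product. The negated AE form combines directly with the AE clauses of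
  \<open>probabilistically_solves\<close>, without measurability of events about runs.\<close>

lemma coin_space_cylinder_not_null:
  assumes "finite J" and "\<And>t r V. (t, r, V) \<in> J \<Longrightarrow> f (t, r, V) \<in> set_pmf (P V)"
  shows "\<not> (AE \<omega> in coin_space P. \<exists>j\<in>J. \<omega> j \<noteq> f j)"
proof
  assume *: "AE \<omega> in coin_space P. \<exists>j\<in>J. \<omega> j \<noteq> f j"
  let ?M = "\<lambda>(t :: nat, r :: nat, V). measure_pmf (P V)"
  interpret product_prob_space ?M UNIV
    by (intro product_prob_spaceI) (auto split: prod.splits intro: measure_pmf.prob_space_axioms)
  let ?C = "{\<omega> \<in> space (coin_space P). \<forall>j\<in>J. \<omega> j \<in> {f j}}"
  have "emeasure (coin_space P) ?C = (\<Prod>j\<in>J. emeasure (?M j) {f j})"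
    unfolding coin_space_def
    by (rule emeasure_PiM_Collect) (use assms in \<open>auto split: prod.splits\<close>)
  moreover have "emeasure (?M j) {f j} \<noteq> 0" if "j \<in> J" for j
    using assms(2) that by (cases j) (auto simp: emeasure_pmf_single set_pmf_iff)
  ultimately have "emeasure (coin_space P) ?C \<noteq> 0"
    using \<open>finite J\<close> by auto
  moreover have "emeasure (coin_space P) ?C = 0"
  proof (rule emeasure_eq_0_AE)
    show "AE \<omega> in coin_space P. \<not> (\<forall>j\<in>J. \<omega> j \<in> {f j})"
      using * by eventually_elim auto
  qed
  ultimately show False ..
qed

lemma length_run_history [simp]: "length (run_history n act edge p \<omega> t) = Suc t"
  by (induction t) (auto simp: Let_def)

lemma run_0 [simp]: "run n act edge p \<omega> 0 = p"
  by (simp add: run_def)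

lemma length_step [simp]: "length (step n p dec e) = length p"
  by (simp add: step_def)

lemma run_Suc:
  fixes n act edge p \<omega> t
  defines "h \<equiv> run_history n act edge p \<omega> t" and "q \<equiv> run n act edge p \<omega> t"
  defines "dec \<equiv> (\<lambda>r. if r \<in> act h then \<omega> (t, r, view (config n q) (q ! r)) else Idle)"
  shows "run n act edge p \<omega> (Suc t) = step n q dec (edge h dec)"
  unfolding dec_def q_def h_def run_def by (simp add: Let_def)

lemma length_run [simp]: "length (run n act edge p \<omega> t) = length p"
  by (induction t) (auto simp: run_Suc)

lemma step_cong:
  assumes "\<And>r. r < length p \<Longrightarrow> dec r = dec' r" "\<And>r. r < length p \<Longrightarrow> e r = e' r"
  shows "step n p dec e = step n p dec' e'"
  using assms by (simp add: step_def)

lemma possible_step_length: "possible_step n P p A q \<Longrightarrow> length q = length p"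
  by (auto simp: possible_step_def)

text \<open>
  Any finite execution can be played against a solver: the scheduler follows it and then
  activates the robots in turn, and the required random choices have positive probability.
\<close>

lemma exploration_extends_path:
  assumes P: "exploration_protocol n k P" and "k > 0" and init: "initial n k (X 0)"
    and steps: "\<And>t. t < T \<Longrightarrow> possible_step n P (X t) (A t) (X (Suc t))"
  obtains Y where "\<And>t. t \<le> T \<Longrightarrow> Y t = X t"
    and "\<And>t. t \<ge> T \<Longrightarrow> possible_step n P (Y t) {t mod k} (Y (Suc t))"
    and "terminates n P Y" and "visits_all n Y"
proof -
  have len: "length (X t) = k" if "t \<le> T" for t
    using that
  proof (induction t)
    case (Suc t)
    then show ?case using possible_step_length[OF steps[of t]] by simp
  qed (use init in \<open>simp add: initial_def\<close>)
  have "\<exists>dec e. t < T \<longrightarrow>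
      (\<forall>r<k. if r \<in> A t then dec r \<in> set_pmf (P (view (config n (X t)) (X t ! r))) else dec r = Idle) \<and>
      X (Suc t) = step n (X t) dec e" for t
    using steps[of t] len[of t] by (auto simp: possible_step_def)
  then obtain D E where DE: "\<And>t. t < T \<Longrightarrow>
      (\<forall>r<k. if r \<in> A t then D t r \<in> set_pmf (P (view (config n (X t)) (X t ! r))) else D t r = Idle) \<and>
      X (Suc t) = step n (X t) (D t) (E t)"
    by metis
  \<comment> \<open>The activated set depends on the instant alone, and round robin from
    \<open>T\<close> on makes it fair along every sequence of placements. The history at instant
    \<open>t\<close> has \<open>t + 1\<close> entries, hence \<open>length h - 1\<close>
    below.\<close>
  define B where "B = (\<lambda>t. if t < T then A t else {t mod k})"
  define act where "act = (\<lambda>h :: history. B (length h - 1))"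
  define edge where "edge = (\<lambda>(h :: history) (dec :: nat \<Rightarrow> decision). E (length h - 1))"
  define Y where "Y = run n act edge (X 0)"
  have B: "activation k (B t)" for t
    using steps[of t] len[of t] \<open>k > 0\<close> by (auto simp: B_def possible_step_def activation_def)
  have fair: "\<exists>\<^sub>\<infinity>t. r \<in> B t" if "r < k" for r
    unfolding INFM_nat
  proof
    fix m
    \<comment> \<open>The witness is an instant congruent to \<open>r\<close> modulo
      \<open>k\<close> that lies beyond both \<open>m\<close> and \<open>T\<close>.\<close>
    have "m < (m + T + 1) * k + r" "T \<le> (m + T + 1) * k + r"
      using \<open>k > 0\<close> by (cases k; simp)+
    moreover have "((m + T + 1) * k + r) mod k = r"
      using that by (simp add: mod_mult_self3 del: mult_Suc)
    ultimately show "\<exists>t>m. r \<in> B t"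
      unfolding B_def by (intro exI[of _ "(m + T + 1) * k + r"]) auto
  qed
  have fair_act: "fair_scheduler k act"
    using B fair by (auto simp: fair_scheduler_def act_def)
  define good where "good = (\<lambda>\<omega>. (\<forall>t r V. \<omega> (t, r, V) \<in> set_pmf (P V)) \<and>
      (\<forall>t<T. \<forall>r\<in>A t. \<omega> (t, r, view (config n (X t)) (X t ! r)) = D t r))"
  have Y0: "Y \<omega> 0 = X 0" and lenY: "length (Y \<omega> t) = k" for \<omega> t
    using init by (auto simp: Y_def initial_def)
  have Y_Suc: "Y \<omega> (Suc t) = step n (Y \<omega> t)
      (\<lambda>r. if r \<in> B t then \<omega> (t, r, view (config n (Y \<omega> t)) (Y \<omega> t ! r)) else Idle) (E t)" for \<omega> t
    unfolding Y_def run_Suc by (simp add: act_def edge_def)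
  have Y_step: "possible_step n P (Y \<omega> t) (B t) (Y \<omega> (Suc t))" if "good \<omega>" for \<omega> t
    unfolding possible_step_def lenY Y_Suc using B[of t] that
    by (intro conjI exI) (auto simp: good_def)
  have Y_eq: "Y \<omega> t = X t" if "good \<omega>" "t \<le> T" for \<omega> t
    using that(2)
  proof (induction t)
    case (Suc t)
    then have "t < T" "Y \<omega> t = X t" by auto
    then show ?case
      unfolding Y_Suc using DE[OF \<open>t < T\<close>] len[of t] \<open>good \<omega>\<close>
      by (auto simp: good_def B_def intro!: step_cong)
  qed (simp add: Y0)
  \<comment> \<open>The finitely many coordinates of \<omega> that the prescribed execution
    consults.\<close>
  define J where "J = (\<Union>t<T. (\<lambda>r. (t, r, view (config n (X t)) (X t ! r))) ` A t)"
  define f where "f = (\<lambda>(t, r, V :: view). D t r)"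
  have A_sub: "A t \<subseteq> {..<k}" if "t < T" for t
    using steps[OF that] len[of t] that by (auto simp: possible_step_def activation_def)
  have "finite J"
    unfolding J_def using A_sub by (auto intro: finite_subset)
  have f: "f (t, r, V) \<in> set_pmf (P V)" if J: "(t, r, V) \<in> J" for t r V
  proof -
    have *: "t < T" "r \<in> A t" "V = view (config n (X t)) (X t ! r)"
      using J by (auto simp: J_def)
    then show ?thesis
      using DE[OF *(1)] A_sub[OF *(1)] by (auto simp: f_def)
  qed
  have "\<exists>\<omega>. good \<omega> \<and> terminates n P (Y \<omega>) \<and> visits_all n (Y \<omega>)"
    using P unfolding exploration_protocol_def
  proof (elim conjE disjE)
    assume det: "deterministically_solves n k P"
    \<comment> \<open>Any single outcome with possible decisions throughout is enough here: it
      follows \<open>f\<close> on \<open>J\<close> and takes an arbitrary possible decision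
      elsewhere.\<close>
    define \<omega> where "\<omega> = (\<lambda>(t, r, V). if (t, r, V) \<in> J then f (t, r, V) else (SOME a. a \<in> set_pmf (P V)))"
    have "good \<omega>"
      using f by (auto simp: good_def \<omega>_def J_def f_def some_in_eq set_pmf_not_empty)
    moreover have "fair_computation n k P B (Y \<omega>)"
      using init fair Y_step[OF \<open>good \<omega>\<close>] by (auto simp: fair_computation_def Y0)
    ultimately show ?thesis
      using det unfolding deterministically_solves_def by blast
  next
    assume "probabilistically_solves n k P"
    then have ae: "AE \<omega> in coin_space P. terminates n P (Y \<omega>)" "AE \<omega> in coin_space P. visits_all n (Y \<omega>)"
      using fair_act init unfolding probabilistically_solves_def Y_def by blast+
    show ?thesis
    proof (rule ccontr)
      assume none: "\<not> ?thesis"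
      \<comment> \<open>Almost every run succeeds with decisions from the supports. If no good
        outcome did so, almost every outcome would deviate from \<open>f\<close> on
        \<open>J\<close>.\<close>
      have "AE \<omega> in coin_space P. \<exists>j\<in>J. \<omega> j \<noteq> f j"
        using ae AE_coin_space_support
      proof eventually_elim
        case (elim \<omega>)
        then have "\<not> good \<omega>" using none by blast
        then show ?case using elim(3) by (auto simp: good_def J_def f_def)
      qed
      then show False
        using coin_space_cylinder_not_null[where J = J and f = f and P = P] \<open>finite J\<close> f by blast
    qed
  qed
  then obtain \<omega> where w: "good \<omega>" "terminates n P (Y \<omega>)" "visits_all n (Y \<omega>)" by blast
  have "possible_step n P (Y \<omega> t) {t mod k} (Y \<omega> (Suc t))" if "t \<ge> T" for t
    using Y_step[OF w(1), of t] that by (simp add: B_def)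
  then show thesis
    using w Y_eq[OF w(1)] by (intro that[of "Y \<omega>"]) auto
qed

section \<open>Towers, terminal configurations and confinement to a set of nodes\<close>

lemma length_config [simp]: "length (config n p) = n"
  by (simp add: config_def)

lemma config_nth [simp]: "j < n \<Longrightarrow> config n p ! j = count_list p j"
  by (simp add: config_def)

lemma count_list_pos_iff: "count_list p j > 0 \<longleftrightarrow> j \<in> set p"
  by (metis count_list_0_iff gr0I less_irrefl)

lemma distinct_iff_count_list: "distinct p \<longleftrightarrow> (\<forall>j. count_list p j < 2)"
proof (induction p)
  case (Cons x p)
  have "distinct (x # p) \<longleftrightarrow> count_list p x = 0 \<and> (\<forall>j. count_list p j < 2)"
    using Cons by (simp add: count_list_0_iff)
  also have "\<dots> \<longleftrightarrow> (\<forall>j. count_list (x # p) j < 2)"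
    by (force split: if_splits)
  finally show ?case .
qed simp

lemma towerless_config_iff_distinct:
  assumes "set p \<subseteq> {..<n}"
  shows "towerless (config n p) \<longleftrightarrow> distinct p"
proof -
  have "count_list p j = 0" if "j \<ge> n" for j
    using assms that by (auto simp: count_list_0_iff)
  then show ?thesis
    by (auto simp: towerless_def tower_def not_le distinct_iff_count_list)
      (metis not_le_imp_less pos2)
qed

lemma initial_iff_distinct:
  "initial n k p \<longleftrightarrow> length p = k \<and> set p \<subseteq> {..<n} \<and> distinct p"
  by (auto simp: initial_def towerless_config_iff_distinct)

lemma terminal_config_iff:
  assumes "set p \<subseteq> {..<n}"
  shows "terminal P (config n p) \<longleftrightarrow>
    (\<forall>x\<in>set p. set_pmf (P (view (config n p) x)) \<inter> range Move = {})"
  using assms by (auto simp: terminal_def count_list_pos_iff measure_pmf_zero_iff)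

lemma possible_step_terminal:
  assumes "terminal P (config n p)" "set p \<subseteq> {..<n}" "possible_step n P p A q"
  shows "q = p"
proof -
  obtain dec e where dec: "\<forall>r<length p. if r \<in> A then dec r \<in> set_pmf (P (view (config n p) (p ! r)))
      else dec r = Idle" and q: "q = step n p dec e"
    using assms(3) unfolding possible_step_def by blast
  have "dec r = Idle" if r: "r < length p" for r
  proof (cases "dec r")
    case (Move w)
    then have "Move w \<in> set_pmf (P (view (config n p) (p ! r)))"
      using dec r by (metis decision.distinct(1))
    then show ?thesis
      using assms(1) r unfolding terminal_config_iff[OF assms(2)] by (auto dest!: bspec[OF _ nth_mem])
  qed
  then show ?thesis
    unfolding q step_def by (auto simp: target_def intro!: nth_equalityI)
qed

definition step_within :: "nat \<Rightarrow> protocol \<Rightarrow> nat set \<Rightarrow> placement \<Rightarrow> placement \<Rightarrow> bool" where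
  "step_within n P V p q \<longleftrightarrow> (\<exists>A. possible_step n P p A q) \<and> set q \<subseteq> V"

text \<open>A terminal configuration freezes the robots whoever is activated. Reaching it inside
  \<open>V\<close> would therefore leave the nodes outside \<open>V\<close> unvisited
  forever.\<close>

lemma exploration_no_terminal_within:
  assumes P: "exploration_protocol n k P" and "k > 0" and init: "initial n k p"
    and "V \<subset> {..<n}" and "set p \<subseteq> V"
    and path: "(step_within n P V)\<^sup>*\<^sup>* p q"
  shows "\<not> terminal P (config n q)"
proof
  assume terminal: "terminal P (config n q)"
  obtain X T where X: "X 0 = p" "X T = q" "\<And>t. t < T \<Longrightarrow> step_within n P V (X t) (X (Suc t))"
    using path by (metis rtranclp_imp_relpowp relpowp_fun_conv)
  then obtain A where A: "\<And>t. t < T \<Longrightarrow> possible_step n P (X t) (A t) (X (Suc t))"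
    unfolding step_within_def by metis
  have XV: "set (X t) \<subseteq> V" if "t \<le> T" for t
    using that X \<open>set p \<subseteq> V\<close> by (cases t) (auto simp: step_within_def)
  obtain Y where Y: "\<And>t. t \<le> T \<Longrightarrow> Y t = X t"
      "\<And>t. t \<ge> T \<Longrightarrow> possible_step n P (Y t) {t mod k} (Y (Suc t))" "visits_all n Y"
    by (rule exploration_extends_path[OF P \<open>k > 0\<close>, of X T A]) (use init X(1) A in auto)
  have q: "set q \<subseteq> {..<n}"
    using XV[of T] X(2) \<open>V \<subset> {..<n}\<close> by auto
  have "Y t = q" if "t \<ge> T" for t
    using that
  proof (induction t rule: dec_induct)
    case base
    then show ?case using Y(1) X(2) by simp
  next
    case (step t)
    then show ?case using possible_step_terminal[OF terminal q] Y(2)[of t] by simp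
  qed
  then have "set (Y t) \<subseteq> V" for t
    using XV[of T] X(2) XV[of t] Y(1)[of t] by (cases "t \<le> T") auto
  moreover obtain j where "j < n" "j \<notin> V"
    using \<open>V \<subset> {..<n}\<close> by blast
  ultimately show False
    using Y(3) by (simp add: visits_all_def count_list_pos_iff) blast
qed

text \<open>The case \<open>T = 0\<close> of \<open>exploration_extends_path\<close>: pure round
  robin.\<close>

lemma exploration_sequential_run:
  assumes "exploration_protocol n k P" and "k > 0" and "initial n k p"
  obtains X T where "X 0 = p" and "\<And>t. \<exists>r. possible_step n P (X t) {r} (X (Suc t))"
    and "terminal P (config n (X T))"
proof -
  obtain Y where "Y 0 = p" "\<And>t. possible_step n P (Y t) {t mod k} (Y (Suc t))" "terminates n P Y"
    using exploration_extends_path[of n k P "\<lambda>_. p" 0] assms by auto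
  then show thesis
    using that unfolding terminates_def by blast
qed

section \<open>Directions on the ring\<close>

text \<open>
  Nodes are addressed by integers modulo \<open>n\<close>, so that a direction is a sign \<open>s\<close> and \<open>x + s * m\<close>
  is the node \<open>m\<close> steps away from \<open>x\<close> in that direction.
\<close>

definition node :: "nat \<Rightarrow> int \<Rightarrow> nat" where
  "node n x = nat (x mod int n)"

lemma node_less [simp]: "n > 0 \<Longrightarrow> node n x < n"
  by (simp add: node_def nat_less_iff)

lemma node_eq_iff: "n > 0 \<Longrightarrow> node n x = node n y \<longleftrightarrow> int n dvd x - y"
  by (simp add: node_def eq_nat_nat_iff mod_eq_dvd_iff)

lemma node_int [simp]: "i < n \<Longrightarrow> node n (int i) = i"
  by (simp add: node_def)

lemma int_node:
  assumes "n > 0"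
  obtains k where "int (node n x) = x + int n * k"
  using assms that[of "- (x div int n)"] by (simp add: node_def minus_mult_div_eq_mod)

lemma mod_eq_node: "int n dvd int m - x \<Longrightarrow> m mod n = node n x"
  unfolding node_def by (metis mod_eq_dvd_iff nat_int zmod_int)

lemma next_node_node: "n > 0 \<Longrightarrow> next_node n (node n x) = node n (x + 1)"
  unfolding next_node_def by (rule int_node[of n x], assumption, rule mod_eq_node) simp

lemma prev_node_node: "n > 0 \<Longrightarrow> prev_node n (node n x) = node n (x - 1)"
  unfolding prev_node_def by (rule int_node[of n x], assumption, rule mod_eq_node) (simp add: of_nat_diff)

text \<open>\<open>gamma_plus\<close> is the case \<open>s = 1\<close> and
  \<open>gamma_minus\<close> the case \<open>s = -1\<close>; the sign lets mirror-image cases share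
  one proof.\<close>

definition reading :: "nat \<Rightarrow> configuration \<Rightarrow> int \<Rightarrow> int \<Rightarrow> nat list" where
  "reading n c x s = map (\<lambda>m. c ! node n (x + s * int m)) [0..<n]"

lemma gamma_plus_node:
  assumes "length c = n" "n > 0"
  shows "gamma_plus c (node n x) = reading n c x 1"
proof -
  have "(node n x + m) mod n = node n (x + int m)" for m
    by (rule int_node[OF assms(2), of x], rule mod_eq_node) simp
  then show ?thesis by (simp add: gamma_plus_def reading_def Let_def assms(1))
qed

lemma gamma_minus_node:
  assumes "length c = n" "n > 0"
  shows "gamma_minus c (node n x) = reading n c x (-1)"
proof -
  have "(node n x + n - m) mod n = node n (x - int m)" if "m < n" for m
    by (rule int_node[OF assms(2), of x], rule mod_eq_node) (use that in \<open>simp add: of_nat_diff\<close>)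
  then show ?thesis by (simp add: gamma_minus_def reading_def Let_def assms(1))
qed

lemma view_node:
  assumes "length c = n" "n > 0" "s = 1 \<or> s = -1"
  shows "view c (node n x) = Upair (reading n c x s) (reading n c x (- s))"
  using assms by (auto simp: view_def gamma_plus_node gamma_minus_node)

text \<open>The edge choice \<open>s = 1\<close> fits every view: it decides when the view is
  symmetric and is ignored otherwise, where the word itself fixes the direction.\<close>

lemma target_reading:
  assumes "length c = n" "n > 0" "s = 1 \<or> s = -1"
  shows "target c (node n x) (Move (reading n c x s)) (s = 1) = node n (x + s)"
  using assms by (auto simp: target_def gamma_plus_node gamma_minus_node next_node_node prev_node_node)

text \<open>In a symmetric view both directions read the same word, so whichever edge the adversary
  picks, the move follows a direction that reads it.\<close>

lemma target_cases:
  assumes "length c = n" "n > 0" "valid_protocol P" "a \<in> set_pmf (P (view c (node n x)))"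
  obtains "a = Idle" "target c (node n x) a b = node n x"
  | s where "s = 1 \<or> s = -1" "a = Move (reading n c x s)" "target c (node n x) a b = node n (x + s)"
proof (cases a)
  case Idle
  then show ?thesis using that(1) by (simp add: target_def)
next
  case (Move w)
  let ?s = "if reading n c x 1 = reading n c x (-1) then if b then 1 else -1
            else if w = reading n c x 1 then 1 else -1"
  have "a \<in> insert Idle (Move ` set_uprod (view c (node n x)))"
    using assms(3,4) unfolding valid_protocol_def by blast
  then have "w = reading n c x 1 \<or> w = reading n c x (-1)"
    using Move assms(1,2) by (auto simp: view_node[of _ _ 1])
  then show ?thesis
    using Move assms(1,2)
    by (intro that(2)[of ?s])
      (auto simp: target_def gamma_plus_node gamma_minus_node next_node_node prev_node_node)
qed

lemma possible_step_moves:
  assumes "n > 0" "A \<noteq> {}" "A \<subseteq> {..<length p}"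
    and "\<And>r. r \<in> A \<Longrightarrow> p ! r = node n (x r) \<and> (s r = 1 \<or> s r = -1) \<and>
      Move (reading n (config n p) (x r) (s r)) \<in> set_pmf (P (view (config n p) (p ! r)))"
  shows "possible_step n P p A (map (\<lambda>r. if r \<in> A then node n (x r + s r) else p ! r) [0..<length p])"
  unfolding possible_step_def
proof (intro conjI exI)
  let ?dec = "\<lambda>r. if r \<in> A then Move (reading n (config n p) (x r) (s r)) else Idle"
  show "activation (length p) A" using assms by (simp add: activation_def)
  show "\<forall>r<length p. if r \<in> A then ?dec r \<in> set_pmf (P (view (config n p) (p ! r))) else ?dec r = Idle"
  proof (intro allI impI)
    fix r
    show "if r \<in> A then ?dec r \<in> set_pmf (P (view (config n p) (p ! r))) else ?dec r = Idle"
      using assms(4)[of r] by (cases "r \<in> A") auto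
  qed
  show "map (\<lambda>r. if r \<in> A then node n (x r + s r) else p ! r) [0..<length p] = step n p ?dec (\<lambda>r. s r = 1)"
    unfolding step_def
  proof (intro map_cong refl)
    fix r
    show "(if r \<in> A then node n (x r + s r) else p ! r) =
        target (config n p) (p ! r) (?dec r) (s r = 1)"
    proof (cases "r \<in> A")
      case True
      then show ?thesis
        using assms(1) assms(4)[of r] target_reading[of "config n p" n "s r" "x r"] by simp
    qed (simp add: target_def)
  qed
qed

lemma possible_step_singleton_cases:
  assumes "n > 0" "valid_protocol P" "possible_step n P p {r} q" "p ! r = node n x"
  obtains "q = p"
  | s where "s = 1 \<or> s = -1" "r < length p" "q = p[r := node n (x + s)]"
      "Move (reading n (config n p) x s) \<in> set_pmf (P (view (config n p) (p ! r)))"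
proof -
  obtain dec e where dec: "\<forall>u<length p. if u \<in> {r} then dec u \<in> set_pmf (P (view (config n p) (p ! u)))
      else dec u = Idle" and q: "q = step n p dec e" and r: "r < length p"
    using assms(3) unfolding possible_step_def activation_def by auto
  have q': "q = p[r := target (config n p) (p ! r) (dec r) (e r)]"
  proof (rule nth_equalityI)
    fix u assume "u < length q"
    then have u: "u < length p" by (simp add: q)
    then have "q ! u = target (config n p) (p ! u) (dec u) (e u)"
      by (simp add: q step_def)
    then show "q ! u = p[r := target (config n p) (p ! r) (dec r) (e r)] ! u"
      using dec u by (cases "u = r") (auto simp: target_def)
  qed (simp add: q)
  have "dec r \<in> set_pmf (P (view (config n p) (node n x)))"
    using dec r assms(4) by auto
  from target_cases[OF length_config assms(1,2) this, of "e r"] show thesis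
  proof cases
    case 1
    then show ?thesis using that(1) q' assms(4) by (metis list_update_id)
  next
    case (2 s)
    then show ?thesis using that(2)[of s] q' r dec assms(4) by auto
  qed
qed

section \<open>Placements with a tower\<close>

text \<open>Robot \<open>i\<close> is single and the other two stand on \<open>a\<close>, which lies
  \<open>d\<close> steps from it in the positive direction. \<open>d\<close> counts modulo
  \<open>n\<close> and may be negative; at \<open>d = 0\<close> all three robots share
  \<open>a\<close>.\<close>

definition pair_tower :: "nat \<Rightarrow> nat \<Rightarrow> int \<Rightarrow> int \<Rightarrow> placement" where
  "pair_tower n i a d = map (\<lambda>r. node n (if r = i then a - d else a)) [0..<3]"

lemma length_pair_tower [simp]: "length (pair_tower n i a d) = 3"
  by (simp add: pair_tower_def)

lemma pair_tower_nth [simp]: "r < 3 \<Longrightarrow> pair_tower n i a d ! r = node n (if r = i then a - d else a)"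
  by (simp add: pair_tower_def)

lemma less_3_cases: "i < 3 \<longleftrightarrow> i = 0 \<or> i = 1 \<or> i = (2 :: nat)"
  by auto

lemma pair_tower_unfold:
  "pair_tower n i a d = [node n (if i = 0 then a - d else a), node n (if i = 1 then a - d else a),
    node n (if i = 2 then a - d else a)]"
  by (simp add: pair_tower_def upt_rec)

lemma set_pair_tower: "i < 3 \<Longrightarrow> set (pair_tower n i a d) = {node n a, node n (a - d)}"
  by (auto simp: less_3_cases pair_tower_unfold)

lemma count_list_pair_tower:
  "i < 3 \<Longrightarrow> count_list (pair_tower n i a d) y =
    (if y = node n (a - d) then 1 else 0) + (if y = node n a then 2 else 0)"
  by (auto simp: less_3_cases pair_tower_unfold)

lemma node_cong: "int n dvd x - y \<Longrightarrow> node n x = node n y"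
  unfolding node_def by (metis mod_eq_dvd_iff)

lemma pair_tower_cong:
  "int n dvd d - d' \<Longrightarrow> pair_tower n i a d = pair_tower n i a d'"
  using node_cong[of n "a - d" "a - d'"] by (simp add: pair_tower_def dvd_diff_commute)

text \<open>The word read from the single robot's node when the tower is \<open>e\<close> steps
  ahead; \<open>tower_reading\<close> exchanges the roles. The summands add up to 3 on one node when
  \<open>n\<close> divides \<open>e\<close>.\<close>

definition single_reading :: "nat \<Rightarrow> int \<Rightarrow> nat list" where
  "single_reading n e =
    map (\<lambda>m. (if int n dvd int m then 1 else 0) + (if int n dvd int m - e then 2 else 0)) [0..<n]"

definition tower_reading :: "nat \<Rightarrow> int \<Rightarrow> nat list" where
  "tower_reading n e =
    map (\<lambda>m. (if int n dvd int m - e then 1 else 0) + (if int n dvd int m then 2 else 0)) [0..<n]"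

lemma single_reading_cong:
  assumes "int n dvd e - e'"
  shows "single_reading n e = single_reading n e'"
proof -
  have "int n dvd int m - e \<longleftrightarrow> int n dvd int m - e'" for m
    using dvd_add_right_iff[OF assms, of "int m - e"] by simp
  then show ?thesis by (simp add: single_reading_def)
qed

lemma reading_single:
  assumes "i < 3" "n > 0" "s = 1 \<or> s = -1"
  shows "reading n (config n (pair_tower n i a d)) (a - d) s = single_reading n (s * d)"
proof -
  have "int n dvd - int m - d \<longleftrightarrow> int n dvd int m + d" for m
    using dvd_minus_iff[of "int n" "int m + d"] by simp
  then show ?thesis
    using assms by (auto simp: reading_def single_reading_def count_list_pair_tower node_eq_iff)
qed

lemma reading_tower:
  assumes "i < 3" "n > 0" "s = 1 \<or> s = -1"
  shows "reading n (config n (pair_tower n i a d)) a s = tower_reading n (- (s * d))"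
proof -
  have "int n dvd d - int m \<longleftrightarrow> int n dvd int m - d" for m
    by (rule dvd_diff_commute)
  then show ?thesis
    using assms by (auto simp: reading_def tower_reading_def count_list_pair_tower node_eq_iff)
qed

definition single_view :: "nat \<Rightarrow> int \<Rightarrow> view" where
  "single_view n e = Upair (single_reading n e) (single_reading n (- e))"

definition tower_view :: "nat \<Rightarrow> int \<Rightarrow> view" where
  "tower_view n e = Upair (tower_reading n e) (tower_reading n (- e))"

lemma view_single:
  "i < 3 \<Longrightarrow> n > 0 \<Longrightarrow> view (config n (pair_tower n i a d)) (node n (a - d)) = single_view n d"
  by (simp add: view_node[where s = 1] reading_single single_view_def)

lemma view_tower:
  "i < 3 \<Longrightarrow> n > 0 \<Longrightarrow> view (config n (pair_tower n i a d)) (node n a) = tower_view n d"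
  by (simp add: view_node[where s = "-1"] reading_tower tower_view_def)

lemma single_view_minus [simp]: "single_view n (- d) = single_view n d"
  by (auto simp: single_view_def)

lemma tower_view_minus [simp]: "tower_view n (- d) = tower_view n d"
  by (auto simp: tower_view_def)

text \<open>
  \<open>approaches n P e\<close>: the single robot may step in the direction in which the tower is \<open>e\<close> steps
  away. The length \<open>e\<close> matters modulo \<open>n\<close> only; stepping away from a tower at distance \<open>e\<close> is
  approaching it at distance \<open>- e\<close>.
\<close>

definition approaches :: "nat \<Rightarrow> protocol \<Rightarrow> int \<Rightarrow> bool" where
  "approaches n P e \<longleftrightarrow> Move (single_reading n e) \<in> set_pmf (P (single_view n e))"

lemma approaches_cong:
  assumes "int n dvd e - e'"
  shows "approaches n P e \<longleftrightarrow> approaches n P e'"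
proof -
  have "int n dvd (- e) - (- e')"
    using assms by (simp add: dvd_diff_commute)
  then show ?thesis
    unfolding approaches_def single_view_def
    by (simp only: single_reading_cong[OF assms] single_reading_cong)
qed

definition halts :: "nat \<Rightarrow> protocol \<Rightarrow> int \<Rightarrow> bool" where
  "halts n P d \<longleftrightarrow> set_pmf (P (single_view n d)) \<inter> range Move = {} \<and>
    set_pmf (P (tower_view n d)) \<inter> range Move = {}"

lemma halts_minus [simp]: "halts n P (- d) \<longleftrightarrow> halts n P d"
  by (simp add: halts_def)

lemma terminal_pair_tower:
  assumes "i < 3" "n > 0"
  shows "terminal P (config n (pair_tower n i a d)) \<longleftrightarrow> halts n P d"
proof -
  have "set (pair_tower n i a d) \<subseteq> {..<n}"
    using assms by (simp add: set_pair_tower)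
  then show ?thesis
    using assms by (auto simp: terminal_config_iff set_pair_tower view_single view_tower halts_def)
qed

lemma possible_step_single:
  assumes "i < 3" "n > 0" "s = 1 \<or> s = -1" "approaches n P (s * d)"
  shows "possible_step n P (pair_tower n i a d) {i} (pair_tower n i a (d - s))"
proof -
  let ?p = "pair_tower n i a d"
  have "single_view n (s * d) = single_view n d"
    using assms(3) by auto
  then have "Move (reading n (config n ?p) (a - d) s) \<in> set_pmf (P (view (config n ?p) (?p ! i)))"
    using assms by (simp add: reading_single view_single approaches_def)
  then have "possible_step n P ?p {i}
      (map (\<lambda>r. if r \<in> {i} then node n (a - d + s) else ?p ! r) [0..<length ?p])"
    using assms by (intro possible_step_moves) auto
  also have "map (\<lambda>r. if r \<in> {i} then node n (a - d + s) else ?p ! r) [0..<length ?p] =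
      pair_tower n i a (d - s)"
    by (auto simp: pair_tower_def algebra_simps)
  finally show ?thesis .
qed

text \<open>The single robot walks from \<open>s * e\<close> to \<open>s * d\<close> one step at a
  time. Negative distances are allowed and describe walking away. The start \<open>f = e\<close> is
  missing from the last hypothesis because only arrivals must lie in \<open>V\<close>.\<close>

lemma chain_within:
  assumes "i < 3" "n > 0" "s = 1 \<or> s = -1" "d \<le> e"
    and "\<And>f. d < f \<Longrightarrow> f \<le> e \<Longrightarrow> approaches n P f"
    and "node n a \<in> V" "\<And>f. d \<le> f \<Longrightarrow> f < e \<Longrightarrow> node n (a - s * f) \<in> V"
  shows "(step_within n P V)\<^sup>*\<^sup>* (pair_tower n i a (s * e)) (pair_tower n i a (s * d))"
  using assms(4,5,7)
proof (induction d rule: int_le_induct)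
  case (step d)
  have eqs: "s * (s * d) = d" "s * d - s = s * (d - 1)"
    using assms(3) by (auto simp: algebra_simps)
  have "approaches n P (s * (s * d))"
    unfolding eqs using step by simp
  from possible_step_single[OF assms(1,2,3) this, of a]
  have "possible_step n P (pair_tower n i a (s * d)) {i} (pair_tower n i a (s * (d - 1)))"
    unfolding eqs .
  then have "step_within n P V (pair_tower n i a (s * d)) (pair_tower n i a (s * (d - 1)))"
    using step assms(1,6) by (auto simp: step_within_def set_pair_tower)
  with step show ?case
    by (simp add: rtranclp.rtrancl_into_rtrancl)
qed simp

section \<open>Single-robot steps that keep or create a tower\<close>

lemma third_index:
  fixes i r :: nat
  assumes "i < 3" "r < 3" "i \<noteq> r"
  obtains j where "j < 3" "j \<noteq> i" "j \<noteq> r" "\<And>u. u < 3 \<Longrightarrow> u = i \<or> u = r \<or> u = j"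
proof -
  have "{i, r} \<subset> {..<3}"
    using assms by (auto simp: psubset_eq dest!: arg_cong[where f = card])
  then obtain j where j: "j < 3" "j \<noteq> i" "j \<noteq> r" by blast
  have "{i, r, j} = {..<3}"
    by (rule card_subset_eq) (use assms j in auto)
  then show thesis
    using that j by blast
qed

lemma dvd_small_int:
  fixes x m :: int
  shows "m dvd x \<Longrightarrow> \<bar>x\<bar> < m \<Longrightarrow> x = 0"
  using dvd_imp_le_int[of x m] by auto

text \<open>Leaving a common node of all three robots gives distance 1. Otherwise a moving single
  robot changes the distance by at most one, and a robot leaving the tower destroys it unless it
  joins the single robot; this needs distance 1 and leaves distance 1.\<close>

lemma tower_step_cases:
  assumes n: "n > 3" and P: "valid_protocol P" and i: "i < 3" and s: "s = 1 \<or> s = -1"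
    and d: "0 \<le> d" "2 * d \<le> int n"
    and step: "possible_step n P (pair_tower n i a (s * d)) {r} q" and q: "\<not> distinct q"
  obtains i' a' s' d' where "q = pair_tower n i' a' (s' * d')" "i' < 3" "s' = 1 \<or> s' = -1"
    "0 \<le> d'" "2 * d' \<le> int n"
    "d' = d \<or> d' = d + 1 \<and> approaches n P (- d) \<or> d' = d - 1 \<and> approaches n P d \<or> d = 0 \<and> d' = 1"
proof -
  let ?p = "pair_tower n i a (s * d)"
  have n0: "n > 0" using n by simp
  have r: "r < 3" using step by (auto simp: possible_step_def activation_def)
  have "?p ! r = node n (if r = i then a - s * d else a)" using r by simp
  from possible_step_singleton_cases[OF n0 P step this] show thesis
  proof cases
    case 1
    then show ?thesis using that[of i a s d] i s d by simp
  next
    case (2 v)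
    consider "d = 0" | "d > 0" "r = i" | "d > 0" "r \<noteq> i" using d by linarith
    then show ?thesis
    proof cases
      case 1
      have "q = pair_tower n r a (- v * 1)"
        unfolding 2 using 1 r by (intro nth_equalityI) (auto simp: nth_list_update)
      then show ?thesis using that[of r a "- v" 1] 1 2 r n by auto
    next
      case single: 2
      have "single_view n (v * (s * d)) = single_view n (s * d)"
        using 2(1) by auto
      then have ap: "approaches n P (v * (s * d))"
        using 2 single i n0 by (simp add: reading_single view_single approaches_def)
      have q_eq: "q = pair_tower n i a (s * d - v)"
        unfolding 2 using single r by (intro nth_equalityI) (auto simp: nth_list_update algebra_simps)
      show ?thesis
      proof (cases "v = s")
        case True
        then have "v * (s * d) = d" "s * d - v = s * (d - 1)" using s by (auto simp: algebra_simps)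
        then show ?thesis using that[of i a s "d - 1"] q_eq ap s i d single by auto
      next
        case False
        then have *: "v * (s * d) = - d" "s * d - v = s * (d + 1)" using s 2(1) by (auto simp: algebra_simps)
        show ?thesis
        proof (cases "2 * (d + 1) \<le> int n")
          case True
          then show ?thesis using that[of i a s "d + 1"] q_eq ap s i d * by auto
        next
          case False
          \<comment> \<open>Past the halfway point the tower is nearer the other way, at distance
            \<open>n - d - 1\<close>. This is \<open>d\<close> if \<open>n = 2 * d + 1\<close>. If
            \<open>n = 2 * d\<close> it is \<open>d - 1\<close>, and stepping away is then
            approaching from the other side.\<close>
          have "s * (d + 1) - - s * (int n - d - 1) = s * int n" by (simp add: algebra_simps)
          then have "pair_tower n i a (s * (d + 1)) = pair_tower n i a (- s * (int n - d - 1))"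
            by (intro pair_tower_cong) simp
          then have q': "q = pair_tower n i a (- s * (int n - d - 1))"
            using q_eq * by simp
          have "int n = 2 * d \<or> int n - d - 1 = d" using False d by presburger
          moreover have "approaches n P d" if "int n = 2 * d"
            using ap * approaches_cong[of n "- d" d P] that by simp
          ultimately show ?thesis
            using that[of i a "- s" "int n - d - 1"] q' s i d single n False by auto
        qed
      qed
    next
      case 3
      obtain j where j: "j < 3" "j \<noteq> i" "j \<noteq> r" and all: "\<And>u. u < 3 \<Longrightarrow> u = i \<or> u = r \<or> u = j"
        using third_index[OF i r] 3 by metis
      have nth: "q ! i = node n (a - s * d)" "q ! j = node n a" "q ! r = node n (a + v)" "length q = 3"
        unfolding 2 using 3 i j r by auto
      obtain u w where uw: "u < 3" "w < 3" "u \<noteq> w" "q ! u = q ! w"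
        using q nth(4) by (auto simp: distinct_conv_nth)
      \<comment> \<open>As \<open>q\<close> has a tower, the robot \<open>r\<close> must have landed
        on \<open>i\<close>. Since \<open>v + s * d\<close> has absolute value at most
        \<open>1 + n / 2\<close>, less than \<open>n\<close>, the congruence is an equality.\<close>
      have "q ! i \<noteq> q ! j"
        using dvd_small_int[of "int n" "s * d"] 3(1) d n s by (auto simp: nth node_eq_iff)
      moreover have "q ! r \<noteq> q ! j"
        using dvd_small_int[of "int n" "v"] 2(1) n by (auto simp: nth node_eq_iff)
      ultimately have "q ! r = q ! i"
        using uw all[OF uw(1)] all[OF uw(2)] by metis
      then have dvd: "int n dvd v + s * d"
        using n0 by (simp add: nth node_eq_iff)
      have "v + s * d = 0"
        using dvd_small_int[OF dvd] d n s 2(1) 3(1) by auto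
      then have "d = 1" "s = - v"
        using s 2(1) 3(1) by auto
      have "q = pair_tower n j (a + v) (v * 1)"
      proof (rule nth_equalityI)
        fix u assume "u < length q"
        then show "q ! u = pair_tower n j (a + v) (v * 1) ! u"
          using all[of u] nth \<open>d = 1\<close> \<open>s = - v\<close> i j r 3 by auto
      qed (simp add: nth)
      then show ?thesis
        using that[of j "a + v" v 1] j 2(1) n \<open>d = 1\<close> by auto
    qed
  qed
qed

lemma node_offset:
  assumes "b < n"
  obtains s d where "s = 1 \<or> s = -1" "0 \<le> d" "2 * d \<le> int n" "b = node n (a - s * d)"
proof -
  let ?e = "(a - int b) mod int n"
  have e: "0 \<le> ?e" "?e < int n" using assms by auto
  have "int n dvd (a - int b) - ?e"
    by (simp add: mod_eq_dvd_iff[symmetric])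
  then have "int n dvd (a - ?e) - int b"
    by (simp add: algebra_simps)
  then have b: "b = node n (a - ?e)"
    using node_cong[of n "a - ?e" "int b"] assms by simp
  show thesis
  proof (cases "2 * ?e \<le> int n")
    case True
    then show ?thesis using that[of 1 ?e] e b by simp
  next
    case False
    have "node n (a - ?e) = node n (a - - 1 * (int n - ?e))"
      by (rule node_cong) simp
    then show ?thesis using that[of "-1" "int n - ?e"] e b False by simp
  qed
qed

text \<open>The mover \<open>r\<close> steps from \<open>a - v\<close> onto an occupied node
  \<open>a\<close>, so no new node is visited. The third robot becomes the single one, and
  \<open>p\<close> is recovered from \<open>q\<close> by undoing the move.\<close>

lemma first_tower:
  assumes n: "n > 0" and P: "valid_protocol P" and init: "initial n 3 p"
    and step: "possible_step n P p {r} q" and q: "\<not> distinct q"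
  obtains i a s d v where "i < 3" "r < 3" "r \<noteq> i" "s = 1 \<or> s = -1" "0 < d" "2 * d \<le> int n" "v = 1 \<or> v = -1"
    "q = pair_tower n i a (s * d)" "p = q[r := node n (a - v)]" "set q \<subseteq> set p"
    "Move (reading n (config n p) (a - v) v) \<in> set_pmf (P (view (config n p) (p ! r)))"
proof -
  have p: "length p = 3" "set p \<subseteq> {..<n}" "distinct p"
    using init by (auto simp: initial_iff_distinct)
  have r: "r < 3" using step p by (auto simp: possible_step_def activation_def)
  define x where "x = int (p ! r)"
  have "p ! r < n" using p r by (metis nth_mem subsetD lessThan_iff)
  then have x: "p ! r = node n x" by (simp add: x_def)
  from possible_step_singleton_cases[OF n P step this] show thesis
  proof cases
    case 1
    then show ?thesis using q p by simp
  next
    case (2 v)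
    have "node n (x + v) \<in> set p"
      using q p r unfolding 2 by (metis distinct_list_update DiffD1)
    then obtain j where j: "j < 3" "p ! j = node n (x + v)"
      using p by (metis in_set_conv_nth)
    have "j \<noteq> r"
    proof
      assume "j = r"
      then have "q = p" unfolding 2 using j by (metis list_update_id)
      then show False using q p by simp
    qed
    then obtain i where i: "i < 3" "i \<noteq> j" "i \<noteq> r" and all: "\<And>u. u < 3 \<Longrightarrow> u = j \<or> u = r \<or> u = i"
      using third_index[OF j(1) r] by metis
    have "p ! i < n" using p i by (metis nth_mem subsetD lessThan_iff)
    then obtain s d where sd: "s = 1 \<or> s = -1" "0 \<le> d" "2 * d \<le> int n" "p ! i = node n (x + v - s * d)"
      by (rule node_offset)
    have "p ! i \<noteq> p ! j" using p i(1,2) j(1) nth_eq_iff_index_eq[of p i j] by simp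
    then have "d \<noteq> 0" using sd(4) j by auto
    have q_eq: "q = pair_tower n i (x + v) (s * d)"
    proof (rule nth_equalityI)
      fix u assume "u < length q"
      then show "q ! u = pair_tower n i (x + v) (s * d) ! u"
        using all[of u] i j r p sd(4) \<open>j \<noteq> r\<close> by (auto simp: 2)
    qed (simp add: 2 p)
    have "p = q[r := node n (x + v - v)]"
      unfolding 2 by (simp flip: x)
    moreover have "set q \<subseteq> set p"
      unfolding 2 using \<open>node n (x + v) \<in> set p\<close> by (metis set_update_subset_insert insert_absorb)
    ultimately show ?thesis
      using that[of i s d v "x + v"] i r sd \<open>d \<noteq> 0\<close> q_eq 2 by auto
  qed
qed

section \<open>Executions ending in a tower\<close>

lemma possible_step_nodes:
  assumes "n > 0" "valid_protocol P" "possible_step n P p {r} q" "set p \<subseteq> {..<n}"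
  shows "set q \<subseteq> {..<n}"
proof -
  have "r < length p"
    using assms(3) by (auto simp: possible_step_def activation_def)
  then have "p ! r < n"
    using assms(4) by (metis nth_mem subsetD lessThan_iff)
  then have "p ! r = node n (int (p ! r))" by simp
  from possible_step_singleton_cases[OF assms(1-3) this] show ?thesis
  proof cases
    case 1
    then show ?thesis using assms(4) by simp
  next
    case (2 s)
    have "set q \<subseteq> insert (node n (int (p ! r) + s)) (set p)"
      unfolding 2 by (rule set_update_subset_insert)
    then show ?thesis using assms(1,4) by auto
  qed
qed

lemma psubset_nodes: "set p \<subseteq> {..<n} \<Longrightarrow> length p < n \<Longrightarrow> set p \<subset> {..<n}"
  using card_length[of p] by (metis card_lessThan not_le psubsetI)

text \<open>
  A sequential execution ends with tower configurations only. From one of these to the next the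
  distance of the single robot to the tower changes by at most one, so every distance between the
  first and the last is crossed in the same direction.
\<close>

lemma exploration_tower_phase:
  assumes n: "n > 3" and P: "exploration_protocol n 3 P"
  obtains p q r i a s d v e
  where "initial n 3 p" "possible_step n P p {r} q" "i < 3" "r < 3" "r \<noteq> i"
    "s = 1 \<or> s = -1" "0 < d" "2 * d \<le> int n" "v = 1 \<or> v = -1"
    "q = pair_tower n i a (s * d)" "p = q[r := node n (a - v)]" "set q \<subseteq> set p"
    "Move (reading n (config n p) (a - v) v) \<in> set_pmf (P (view (config n p) (p ! r)))"
    "0 \<le> e" "2 * e \<le> int n" "halts n P e"
    "d \<le> e \<and> (\<forall>f. d \<le> f \<longrightarrow> f < e \<longrightarrow> approaches n P (- f)) \<or>
     e \<le> d \<and> (\<forall>f. e < f \<longrightarrow> f \<le> d \<longrightarrow> approaches n P f)"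
proof -
  have n0: "n > 0" using n by simp
  have valid: "valid_protocol P" using P by (simp add: exploration_protocol_def)
  have "initial n 3 [0, 1, 2]" using n by (auto simp: initial_iff_distinct)
  then obtain X T where X0: "X 0 = [0, 1, 2]"
    and X_step: "\<And>t. \<exists>r. possible_step n P (X t) {r} (X (Suc t))"
    and X_T: "terminal P (config n (X T))"
    using exploration_sequential_run[OF P] by (metis zero_less_numeral)
  have X: "length (X t) = 3 \<and> set (X t) \<subseteq> {..<n}" for t
  proof (induction t)
    case (Suc t)
    obtain r where "possible_step n P (X t) {r} (X (Suc t))" using X_step by blast
    then show ?case
      using Suc possible_step_length possible_step_nodes[OF n0 valid] by metis
  qed (use X0 n in auto)
  \<comment> \<open>A towerless terminal placement could itself be initial, and would then visit
    only three nodes.\<close>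
  have "\<not> distinct (X T)"
  proof
    assume "distinct (X T)"
    then have "initial n 3 (X T)" using X by (simp add: initial_iff_distinct)
    moreover have "set (X T) \<subset> {..<n}" using X n by (intro psubset_nodes) auto
    ultimately show False
      using exploration_no_terminal_within[OF P, of "X T" "set (X T)" "X T"] X_T by simp
  qed
  \<comment> \<open>\<open>u\<close> is the last towerless instant up to \<open>T\<close>, so the
    step after it creates the final tower phase.\<close>
  define S where "S = {t. t \<le> T \<and> distinct (X t)}"
  define u where "u = Max S"
  have "finite S" "0 \<in> S" using X0 by (auto simp: S_def)
  then have "u \<in> S" unfolding u_def by (intro Max_in) auto
  then have u: "u < T" "distinct (X u)"
    using \<open>\<not> distinct (X T)\<close> by (auto simp: S_def order.strict_iff_order)
  have after: "\<not> distinct (X t)" if "u < t" "t \<le> T" for t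
    using Max_ge[OF \<open>finite S\<close>, of t] that unfolding u_def[symmetric] by (auto simp: S_def)
  have init: "initial n 3 (X u)" using X u by (simp add: initial_iff_distinct)
  obtain r where r: "possible_step n P (X u) {r} (X (Suc u))" using X_step by blast
  have nd: "\<not> distinct (X (Suc u))" using after u by simp
  obtain i a s d v where
    ft: "i < 3" "r < 3" "r \<noteq> i" "s = 1 \<or> s = -1" "0 < d" "2 * d \<le> int n" "v = 1 \<or> v = -1"
      "X (Suc u) = pair_tower n i a (s * d)" "X u = (X (Suc u))[r := node n (a - v)]"
      "set (X (Suc u)) \<subseteq> set (X u)"
      "Move (reading n (config n (X u)) (a - v) v) \<in> set_pmf (P (view (config n (X u)) (X u ! r)))"
    by (rule first_tower[OF n0 valid init r nd])
  define R where "R e \<longleftrightarrow> d \<le> e \<and> (\<forall>f. d \<le> f \<longrightarrow> f < e \<longrightarrow> approaches n P (- f)) \<or>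
     e \<le> d \<and> (\<forall>f. e < f \<longrightarrow> f \<le> d \<longrightarrow> approaches n P f)" for e
  have "\<exists>i a s e. X t = pair_tower n i a (s * e) \<and> i < 3 \<and> (s = 1 \<or> s = -1) \<and>
      0 \<le> e \<and> 2 * e \<le> int n \<and> R e" if "Suc u \<le> t" "t \<le> T" for t
    using that
  proof (induction t rule: dec_induct)
    case base
    have "R d" by (auto simp: R_def)
    then show ?case using ft by (metis less_imp_le)
  next
    case (step t)
    then obtain i a s e where inv: "X t = pair_tower n i a (s * e)" "i < 3" "s = 1 \<or> s = -1"
        "0 \<le> e" "2 * e \<le> int n" "R e"
      by auto
    obtain r where "possible_step n P (pair_tower n i a (s * e)) {r} (X (Suc t))"
      using X_step[of t] inv(1) by metis
    moreover have "\<not> distinct (X (Suc t))" using after step by simp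
    ultimately obtain i' a' s' e' where new: "X (Suc t) = pair_tower n i' a' (s' * e')" "i' < 3"
        "s' = 1 \<or> s' = -1" "0 \<le> e'" "2 * e' \<le> int n"
        "e' = e \<or> e' = e + 1 \<and> approaches n P (- e) \<or> e' = e - 1 \<and> approaches n P e \<or> e = 0 \<and> e' = 1"
      by (rule tower_step_cases[OF n valid inv(2-5)])
    \<comment> \<open>A step outward from \<open>d\<close> extends the chain of crossed distances; a
      step back towards \<open>d\<close> merely shortens it. The unconditional step from 0 to 1 is
      of the second kind, as \<open>d > 0\<close>.\<close>
    have "R e'"
    proof -
      have up: "R (e + 1)" if "approaches n P (- e)"
        using inv(6) that unfolding R_def by (smt (verit))
      have down: "R (e - 1)" if "approaches n P e"
        using inv(6) that unfolding R_def by (smt (verit))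
      have "R 1" if "e = 0"
        using inv(6) that ft(5) unfolding R_def by (smt (verit))
      then show ?thesis using new(6) up down inv(6) by auto
    qed
    then show ?case using new by blast
  qed
  then obtain i' a' s' e where end_state: "X T = pair_tower n i' a' (s' * e)" "i' < 3"
      "s' = 1 \<or> s' = -1" "0 \<le> e" "2 * e \<le> int n" "R e"
    using u by (metis Suc_leI order_refl)
  have "halts n P (s' * e)"
    using X_T end_state(1,2) n0 by (simp add: terminal_pair_tower)
  then have "halts n P e" using end_state(3) by auto
  then show thesis
    using that[OF init r ft end_state(4,5)] end_state(6) unfolding R_def by blast
qed

text \<open>
  The case that the counting argument leaves open for \<open>n = 4\<close>. Both ends of a block of three robots
  may move to the middle; two robots of the resulting tower then move together to one side, and the
  third one moves to the other side, where the protocol stops without having left the block.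
\<close>

lemma no_exploration_from_block:
  fixes s :: int
  assumes n: "n > 3" and P: "exploration_protocol n 3 P" and i: "i < 3" and r: "r < 3" "r \<noteq> i"
    and s: "s = 1 \<or> s = -1"
    and p: "p = (pair_tower n i a s)[r := node n (a + s)]"
    and move: "Move (reading n (config n p) (a + s) (- s)) \<in> set_pmf (P (view (config n p) (p ! r)))"
    and away: "approaches n P (- 1)"
  shows "\<not> halts n P 2"
proof
  assume halts: "halts n P 2"
  have n0: "n > 0" using n by simp
  have valid: "valid_protocol P" using P by (simp add: exploration_protocol_def)
  have len: "length p = 3" by (simp add: p)
  obtain j where j: "j < 3" "j \<noteq> i" "j \<noteq> r" and all: "\<And>u. u < 3 \<Longrightarrow> u = i \<or> u = r \<or> u = j"
    using third_index[OF i r(1)] r(2) by metis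
  have nth: "p ! i = node n (a - s)" "p ! r = node n (a + s)" "p ! j = node n a"
    using i r j by (auto simp: p)
  have set_p: "set p = {node n (a + s), node n a, node n (a - s)}"
  proof -
    have "set p = (!) p ` {i, r, j}"
    proof -
      have "{i, r, j} = {..<3}" using all i r j by auto
      then show ?thesis by (simp add: len set_conv_nth) auto
    qed
    then show ?thesis using nth by auto
  qed
  have distinct_nodes: "node n (a + s) \<noteq> node n a" "node n (a - s) \<noteq> node n a"
      "node n (a + s) \<noteq> node n (a - s)"
    using s n dvd_small_int[of "int n" s] dvd_small_int[of "int n" "2 * s"]
    by (auto simp: node_eq_iff)
  then have "card (set p) = 3" by (simp add: set_p)
  then have "distinct p" using len by (simp add: card_distinct)
  have sub: "set p \<subseteq> {..<n}" using n0 by (auto simp: set_p)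
  have init: "initial n 3 p"
    using \<open>distinct p\<close> len sub by (simp add: initial_iff_distinct)
  have proper: "set p \<subset> {..<n}" using sub len n by (intro psubset_nodes) auto
  have no_halt: "\<not> terminal P (config n q)" if "(step_within n P (set p))\<^sup>*\<^sup>* p q" for q
    by (rule exploration_no_terminal_within[OF P _ init proper _ that]) auto
  have count: "count_list p y = (if y \<in> set p then 1 else 0)" for y
    using \<open>distinct p\<close> count_list_pos_iff[of p y]
    by (auto simp: distinct_iff_count_list dest!: spec[of _ y])
  \<comment> \<open>The block is symmetric about its middle \<open>a\<close>. Hence its two ends
    have the same view and may make mirror-image moves.\<close>
  have refl: "count_list p (node n (a + z)) = count_list p (node n (a - z))" for z
  proof -
    have "node n (a + z) \<in> set p \<longleftrightarrow> int n dvd z - s \<or> int n dvd z \<or> int n dvd z + s"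
      using n0 by (auto simp: set_p node_eq_iff)
    also have "\<dots> \<longleftrightarrow> node n (a - z) \<in> set p"
      using n0 dvd_minus_iff[of "int n" "z - s"] dvd_minus_iff[of "int n" "z + s"]
      by (auto simp: set_p node_eq_iff)
    finally show ?thesis by (simp add: count)
  qed
  have reading_refl: "reading n (config n p) (a + x) w = reading n (config n p) (a - x) (- w)" for x w
    using refl[of "x + w * int m" for m] n0 by (simp add: reading_def algebra_simps)
  have view_refl: "view (config n p) (p ! i) = view (config n p) (p ! r)"
    using reading_refl[of s 1] reading_refl[of s "-1"] n0
    by (simp add: nth view_node[where s = 1] Upair_inject)

  let ?q1 = "pair_tower n i a 0"
  have "possible_step n P p {r, i}
      (map (\<lambda>u. if u \<in> {r, i} then node n ((if u = r then a + s else a - s) + (if u = r then - s else s)) else p ! u)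
        [0..<length p])"
  proof (rule possible_step_moves)
    fix u assume "u \<in> {r, i}"
    then show "p ! u = node n (if u = r then a + s else a - s) \<and>
        ((if u = r then - s else s) = 1 \<or> (if u = r then - s else s) = -1) \<and>
        Move (reading n (config n p) (if u = r then a + s else a - s) (if u = r then - s else s))
          \<in> set_pmf (P (view (config n p) (p ! u)))"
      using move s reading_refl[of s "- s"] view_refl nth r by auto
  qed (use i r n0 len in auto)
  also have "map (\<lambda>u. if u \<in> {r, i} then node n ((if u = r then a + s else a - s) + (if u = r then - s else s)) else p ! u)
        [0..<length p] = ?q1"
    using nth all len by (intro nth_equalityI) force+
  finally have step1: "step_within n P (set p) p ?q1"
    using i by (auto simp: step_within_def set_pair_tower set_p)

  \<comment> \<open>With all robots on one node, single robot and tower see the same, and both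
    directions read the same word. Once some robot can move, all can, and the adversary picks their
    directions.\<close>
  have view_eq: "single_reading n 0 = tower_reading n 0" "single_view n 0 = tower_view n 0"
    by (simp_all add: single_reading_def tower_reading_def single_view_def tower_view_def add.commute)
  have "\<not> halts n P 0"
    using no_halt[of ?q1] step1 i n0 by (simp add: terminal_pair_tower r_into_rtranclp)
  then obtain w where w: "Move w \<in> set_pmf (P (tower_view n 0))"
    by (auto simp: halts_def view_eq)
  then have "Move w \<in> insert Idle (Move ` set_uprod (tower_view n 0))"
    using valid unfolding valid_protocol_def by blast
  then have "w = tower_reading n 0"
    by (auto simp: tower_view_def)

  \<comment> \<open>\<open>r\<close> and \<open>j\<close> form a tower on \<open>a + s\<close>, with
    \<open>i\<close> left on \<open>a\<close>. Then \<open>i\<close> steps away to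
    \<open>a - s\<close>, still within the block.\<close>
  let ?q2 = "pair_tower n i (a + s) s"
  have "possible_step n P ?q1 {r, j}
      (map (\<lambda>u. if u \<in> {r, j} then node n (a + s) else ?q1 ! u) [0..<length ?q1])"
  proof (rule possible_step_moves)
    fix u assume "u \<in> {r, j}"
    then show "?q1 ! u = node n a \<and> (s = 1 \<or> s = -1) \<and>
        Move (reading n (config n ?q1) a s) \<in> set_pmf (P (view (config n ?q1) (?q1 ! u)))"
      using s r i j w n0 \<open>w = _\<close> reading_tower[of i n s a 0] view_tower[of i n a 0] by auto
  qed (use j r n0 in auto)
  also have "map (\<lambda>u. if u \<in> {r, j} then node n (a + s) else ?q1 ! u) [0..<length ?q1] = ?q2"
    using all j r by (intro nth_equalityI) force+
  finally have step2: "step_within n P (set p) ?q1 ?q2"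
    using i by (auto simp: step_within_def set_pair_tower set_p)

  let ?q3 = "pair_tower n i (a + s) (2 * s)"
  have "possible_step n P ?q2 {i} (pair_tower n i (a + s) (s - - s))"
    by (rule possible_step_single) (use i n0 s away in auto)
  then have step3: "step_within n P (set p) ?q2 ?q3"
    using i by (auto simp: step_within_def set_pair_tower set_p)
  have "(step_within n P (set p))\<^sup>*\<^sup>* p ?q3"
    using step1 step2 step3 by (meson rtranclp.rtrancl_into_rtrancl rtranclp.rtrancl_refl)
  from no_halt[OF this] show False
    using halts s i n0 by (auto simp: terminal_pair_tower)
qed

section \<open>Counting the visited nodes, and the remaining case \<open>n = 4\<close>\<close>

theorem theorem2:
  fixes n :: nat
  assumes "n > 3"
  shows "\<not> (\<exists>P. exploration_protocol n 3 P)"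
proof
  assume "\<exists>P. exploration_protocol n 3 P"
  then obtain P where P: "exploration_protocol n 3 P" ..
  have n0: "n > 0" using assms by simp
  obtain p q r i a s d v e where
    init: "initial n 3 p" and step: "possible_step n P p {r} q" and ir: "i < 3" "r < 3" "r \<noteq> i"
    and s: "s = 1 \<or> s = -1" and d: "0 < d" "2 * d \<le> int n" and v: "v = 1 \<or> v = -1"
    and q: "q = pair_tower n i a (s * d)" and p: "p = q[r := node n (a - v)]" and qp: "set q \<subseteq> set p"
    and move: "Move (reading n (config n p) (a - v) v) \<in> set_pmf (P (view (config n p) (p ! r)))"
    and e: "0 \<le> e" "2 * e \<le> int n" "halts n P e"
    and chain: "d \<le> e \<and> (\<forall>f. d \<le> f \<longrightarrow> f < e \<longrightarrow> approaches n P (- f)) \<or>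
     e \<le> d \<and> (\<forall>f. e < f \<longrightarrow> f \<le> d \<longrightarrow> approaches n P f)"
    by (rule exploration_tower_phase[OF assms P])
  have p': "length p = 3" "set p \<subseteq> {..<n}" "distinct p"
    using init by (auto simp: initial_iff_distinct)
  have a: "node n a \<in> set p"
    using qp ir by (auto simp: q set_pair_tower)
  \<comment> \<open>If the single robot can walk from distance \<open>h\<close> to a halting
    distance \<open>g\<close>, the nodes of \<open>p\<close> and those of the walk must cover the
    ring. Distance 0 may be omitted from \<open>F\<close>: it is the tower's node, already in
    \<open>p\<close>.\<close>
  have visited: "set p \<union> (\<lambda>f. node n (a - w * f)) ` F = {..<n}"
    if w: "w = 1 \<or> w = -1" "q = pair_tower n i a (w * h)" and gh: "g \<le> h" "halts n P g"
      and ap: "\<And>f. g < f \<Longrightarrow> f \<le> h \<Longrightarrow> approaches n P f" and F: "{g..<h} \<subseteq> insert 0 F"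
    for w g h :: int and F
  proof (rule ccontr)
    let ?V = "set p \<union> (\<lambda>f. node n (a - w * f)) ` F"
    assume "?V \<noteq> {..<n}"
    moreover have "?V \<subseteq> {..<n}" using p' n0 by auto
    ultimately have V: "?V \<subset> {..<n}" by blast
    have "node n (a - w * f) \<in> ?V" if "g \<le> f" "f < h" for f
    proof (cases "f = 0")
      case False
      then have "f \<in> F" using F that by auto
      then show ?thesis by blast
    qed (use a in simp)
    then have "(step_within n P ?V)\<^sup>*\<^sup>* q (pair_tower n i a (w * g))"
      unfolding w(2) using ir n0 w gh ap a by (intro chain_within) auto
    moreover have "step_within n P ?V p q"
      using step qp by (auto simp: step_within_def)
    ultimately have "(step_within n P ?V)\<^sup>*\<^sup>* p (pair_tower n i a (w * g))"
      by (rule converse_rtranclp_into_rtranclp[rotated])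
    then have "\<not> terminal P (config n (pair_tower n i a (w * g)))"
      by (intro exploration_no_terminal_within[OF P _ init V]) auto
    then show False
      using gh w ir n0 by (auto simp: terminal_pair_tower)
  qed
  have count: "n \<le> 3 + card F" if "set p \<union> g ` F = {..<n}" "finite F" for F :: "int set" and g
  proof -
    have "n = card (set p \<union> g ` F)" using that by simp
    also have "\<dots> \<le> card (set p) + card (g ` F)" by (rule card_Un_le)
    also have "\<dots> \<le> 3 + card F"
      using card_length[of p] p' card_image_le[OF that(2), of g] by simp
    finally show ?thesis .
  qed
  from chain show False
  proof (elim disjE conjE)
    assume "e \<le> d" and ap: "\<forall>f. e < f \<longrightarrow> f \<le> d \<longrightarrow> approaches n P f"
    \<comment> \<open>Walking towards the tower adds at most \<open>d - 1\<close> nodes, so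
      \<open>n \<le> d + 2\<close> and \<open>2 * d \<le> n\<close> leave only \<open>n = 4\<close>,
      \<open>d = 2\<close>.\<close>
    have "n \<le> 3 + card {1..<d}"
      by (rule count[OF visited[of s d e]]) (use s q \<open>e \<le> d\<close> e ap in auto)
    then have nd: "n = 4" "d = 2" using d assms by auto
    \<comment> \<open>The single robot is now opposite the tower and may approach from either side.
      Walking through \<open>a - v\<close>, the node that \<open>r\<close> came from, adds nothing
      to \<open>set p\<close>.\<close>
    have "set p \<union> (\<lambda>f. node n (a - v * f)) ` {1} = {..<n}"
    proof (rule visited)
      have "int n dvd s * d - v * d" using nd s v by auto
      then show "q = pair_tower n i a (v * d)" unfolding q by (rule pair_tower_cong)
    qed (use v e \<open>e \<le> d\<close> ap nd in auto)
    moreover have "node n (a - v) \<in> set p"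
      using ir by (simp add: p q set_update_memI)
    ultimately have "set p = {..<n}" by (simp add: insert_absorb)
    then show False using psubset_nodes[of p n] p' assms by simp
  next
    assume "d \<le> e" and ap: "\<forall>f. d \<le> f \<longrightarrow> f < e \<longrightarrow> approaches n P (- f)"
    have ap': "approaches n P f" if "- e < f" "f \<le> - d" for f
      using ap[rule_format, of "- f"] that by simp
    \<comment> \<open>Walking away is approaching with negated distances and direction; it adds at
      most \<open>e - d \<le> n / 2 - 1\<close> nodes.\<close>
    have "n \<le> 3 + card {- e..<- d}"
      by (rule count[OF visited[of "- s" "- d" "- e"]]) (use s q \<open>d \<le> e\<close> e ap' in auto)
    then have nd: "n = 4" "d = 1" "e = 2" using d e assms by auto
    \<comment> \<open>\<open>r\<close> came from \<open>a - v\<close> and \<open>i\<close> stands on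
      \<open>a - s\<close>; being distinct, they are the two ends of a block around
      \<open>a\<close>.\<close>
    have "p ! r \<noteq> p ! i"
      using p' ir by (simp add: nth_eq_iff_index_eq)
    then have "v = - s"
      using ir s v nd by (auto simp: p q)
    then show False
      using no_exploration_from_block[OF assms P ir s, of p a] p q move nd e ap by auto
  qed
qed

end
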